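(* Let $\lambda_1,\lambda_2>0$ be constants with $\frac14<\frac{\lambda_2}{\lambda_1}<1$ or $1<\frac{\lambda_2}{\lambda_1}<4$. Then there exists at most one pair of functions $y_1,y_2\in C^\infty([0,1])$ such that, with $K=e^{y_1}$ and $\phi=e^{y_2}$, the equations $$y_1''+\tfrac16(y_1')^2+\tfrac13(y_2')^2-\frac{1+3x^2}{x(1-x^2)}y_1'=0,$$ $$y_1''+\tfrac12(y_1')^2-\frac{5+7x^2}{x(1-x^2)}y_1'+\frac{8}{(1-x^2)^2}\left(6-8K^{-\frac13}\phi^{-\frac13}+2K^{-\frac13}\phi^{-\frac43}\right)=0,$$ $$y_2''+\tfrac12y_1'y_2'-\frac{2(1+2x^2)}{x(1-x^2)}y_2'+\frac{32}{(1-x^2)^2}K^{-\frac13}\phi^{-\frac13}(\phi^{-1}-1)=0$$ hold for $x\in(0,1)$, together with the boundary conditions $$\phi(0)=\frac{\lambda_2}{\lambda_1},\quad K(1)=\phi(1)=1,\quad y_1'(0)=y_2'(0)=y_1'(1)=y_2'(1)=0.$$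
   Context: Primes denote $d/dx$. The value $K(0)$ is not prescribed. *)

theory Defs
  imports "HOL-Analysis.Analysis"
begin

(* Derivative relative to [0,1]: the usual derivative on (0,1), the one-sided ones at 0 and 1.
   It depends only on the values of f on [0,1]. *)
definition deriv01 :: "(real \<Rightarrow> real) \<Rightarrow> real \<Rightarrow> real" where
  "deriv01 f x = vector_derivative f (at x within {0..1})"

(* C^infinity([0,1]); vector_derivative is total, so the differentiability of every iterated
   derivative is what has to be required (continuity of each of them follows). *)
definition smooth01 :: "(real \<Rightarrow> real) \<Rightarrow> bool" where
  "smooth01 f \<longleftrightarrow> (\<forall>n. (deriv01 ^^ n) f differentiable_on {0..1})"

definition ode_system :: "(real \<Rightarrow> real) \<Rightarrow> (real \<Rightarrow> real) \<Rightarrow> bool" where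
  "ode_system y1 y2 \<longleftrightarrow>
    (let K = (\<lambda>x. exp (y1 x)); \<phi> = (\<lambda>x. exp (y2 x));
         y1' = deriv01 y1; y1'' = deriv01 y1'; y2' = deriv01 y2; y2'' = deriv01 y2'
     in \<forall>x\<in>{0<..<1}.
       y1'' x + 1/6 * (y1' x)\<^sup>2 + 1/3 * (y2' x)\<^sup>2
         - (1 + 3 * x\<^sup>2) / (x * (1 - x\<^sup>2)) * y1' x = 0 \<and>
       y1'' x + 1/2 * (y1' x)\<^sup>2 - (5 + 7 * x\<^sup>2) / (x * (1 - x\<^sup>2)) * y1' x
         + 8 / (1 - x\<^sup>2)\<^sup>2 *
           (6 - 8 * K x powr (-1/3) * \<phi> x powr (-1/3)
              + 2 * K x powr (-1/3) * \<phi> x powr (-4/3)) = 0 \<and>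
       y2'' x + 1/2 * y1' x * y2' x - 2 * (1 + 2 * x\<^sup>2) / (x * (1 - x\<^sup>2)) * y2' x
         + 32 / (1 - x\<^sup>2)\<^sup>2 * K x powr (-1/3) * \<phi> x powr (-1/3)
           * (1 / \<phi> x - 1) = 0)"

definition boundary_conditions ::
    "real \<Rightarrow> real \<Rightarrow> (real \<Rightarrow> real) \<Rightarrow> (real \<Rightarrow> real) \<Rightarrow> bool" where
  "boundary_conditions lam1 lam2 y1 y2 \<longleftrightarrow>
    (let K = (\<lambda>x. exp (y1 x)); \<phi> = (\<lambda>x. exp (y2 x))
     in \<phi> 0 = lam2 / lam1 \<and> K 1 = 1 \<and> \<phi> 1 = 1 \<and>
        deriv01 y1 0 = 0 \<and> deriv01 y2 0 = 0 \<and> deriv01 y1 1 = 0 \<and> deriv01 y2 1 = 0)"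

definition bvp_solution ::
    "real \<Rightarrow> real \<Rightarrow> (real \<Rightarrow> real) \<Rightarrow> (real \<Rightarrow> real) \<Rightarrow> bool" where
  "bvp_solution lam1 lam2 y1 y2 \<longleftrightarrow>
    smooth01 y1 \<and> smooth01 y2 \<and> ode_system y1 y2 \<and> boundary_conditions lam1 lam2 y1 y2"

end

theory Submission
  imports Defs "HOL-Real_Asymp.Real_Asymp"
begin

text \<open>
  In the variable \<open>r = - ln x\<close> the system is the Einstein equation \<open>Ric = -3g\<close> for the
  biaxial metric \<open>g = dr\<^sup>2 + b\<^sup>2 \<theta>\<^sub>1\<^sup>2 + a\<^sup>2 (\<theta>\<^sub>2\<^sup>2 + \<theta>\<^sub>3\<^sup>2)\<close>, where
  \<open>a = K\<^bsup>1/6\<^esup> \<phi>\<^bsup>1/6\<^esup> sinh r\<close> and \<open>b = K\<^bsup>1/6\<^esup> \<phi>\<^bsup>-1/3\<^esup> sinh r\<close>. With \<open>l = a'/a\<close>,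
  \<open>m = b'/b\<close>, \<open>\<kappa> = b/a\<^sup>2\<close> and \<open>n = \<kappa> + l\<close>, the self-dual part of the Weyl tensor is a multiple of
  \<open>w = n (m - \<kappa>) - 1\<close>, and the Bianchi identity becomes \<open>w' = - 3 n w\<close>. Since \<open>n \<sim> 2/r\<close> at the
  nut \<open>r = 0\<close>, regularity there forces \<open>w = 0\<close>. Then \<open>P = 2b/n\<close> and \<open>a\<^sup>2 - P\<close> satisfy
  \<open>P' = n P\<close> and \<open>(a\<^sup>2 - P)' = 2 n (a\<^sup>2 - P)\<close>, so that \<open>(a\<^sup>2 - P) / P\<^sup>2\<close> is constant; its value,
  read off at infinity, is \<open>\<phi>(0) / 4\<close>. The constraint then expresses \<open>n a\<close> through \<open>P\<close>, and
  \<open>P\<^bsup>1/2\<^esup>\<close> solves an autonomous equation with initial value \<open>0\<close>, which determines everything.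
\<close>

lemma deriv_zero_pos_reals_const:
  fixes f :: "real \<Rightarrow> real"
  assumes "\<And>r. r > 0 \<Longrightarrow> (f has_real_derivative 0) (at r)" and "x > 0" "y > 0"
  shows "f x = f y"
proof -
  have "\<exists>c. \<forall>x\<in>{0<..}. f x = c"
    by (rule has_field_derivative_zero_constant) (auto intro: has_field_derivative_at_within assms(1))
  then show ?thesis using assms(2,3) by auto
qed

text \<open>\<open>deriv_l\<close> and \<open>deriv_m\<close> are the components of Ric = -3g along
  the orbits, and \<open>constraint\<close> is the Gauss equation. The coframe is normalised so that
  a = b = 1 is the round unit 3-sphere. The nut conditions make the metric close up at r = 0 like
  flat space; the conditions at infinity fix the squashing \<open>q\<close> of the conformal
  boundary.\<close>

locale biaxial_einstein =
  fixes a b l m :: "real \<Rightarrow> real" and q :: real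
  assumes a_pos: "r > 0 \<Longrightarrow> a r > 0"
    and b_pos: "r > 0 \<Longrightarrow> b r > 0"
    and q_pos: "q > 0"
    and deriv_a: "r > 0 \<Longrightarrow> (a has_real_derivative a r * l r) (at r)"
    and deriv_b: "r > 0 \<Longrightarrow> (b has_real_derivative b r * m r) (at r)"
    and deriv_l: "r > 0 \<Longrightarrow> (l has_real_derivative
      3 - l r * (2 * l r + m r) + 4 / (a r)\<^sup>2 - 2 * (b r / (a r)\<^sup>2)\<^sup>2) (at r)"
    and deriv_m: "r > 0 \<Longrightarrow> (m has_real_derivative
      3 - m r * (2 * l r + m r) + 2 * (b r / (a r)\<^sup>2)\<^sup>2) (at r)"
    and constraint: "r > 0 \<Longrightarrow>
      (l r)\<^sup>2 + 2 * l r * m r = 3 + 4 / (a r)\<^sup>2 - (b r / (a r)\<^sup>2)\<^sup>2"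
    and a_nut: "((\<lambda>r. a r / r) \<longlongrightarrow> 1) (at_right 0)"
    and b_nut: "((\<lambda>r. b r / r) \<longlongrightarrow> 1) (at_right 0)"
    and l_nut: "((\<lambda>r. r * l r) \<longlongrightarrow> 1) (at_right 0)"
    and m_nut: "((\<lambda>r. r * m r) \<longlongrightarrow> 1) (at_right 0)"
    and a_inf: "filterlim a at_top at_top"
    and ratio_inf: "((\<lambda>r. a r / b r) \<longlongrightarrow> sqrt q) at_top"
    and l_inf: "(l \<longlongrightarrow> 1) at_top"
begin

section \<open>Vanishing of the self-dual Weyl tensor\<close>

definition \<kappa> :: "real \<Rightarrow> real" where "\<kappa> r = b r / (a r)\<^sup>2"

definition n :: "real \<Rightarrow> real" where "n r = \<kappa> r + l r"

definition w :: "real \<Rightarrow> real" where "w r = n r * (m r - \<kappa> r) - 1"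

definition P :: "real \<Rightarrow> real" where "P r = 2 * b r / n r"

lemma deriv_\<kappa>: "r > 0 \<Longrightarrow> (\<kappa> has_real_derivative \<kappa> r * (m r - 2 * l r)) (at r)"
  unfolding \<kappa>_def[abs_def]
  using a_pos[of r]
  by (auto intro!: derivative_eq_intros deriv_a deriv_b simp: field_simps power2_eq_square)

text \<open>The equations for \<open>\<kappa>\<close> and \<open>l\<close> are added; eliminating 3
  + 4/a^2 by the constraint leaves a quadratic form that factors.\<close>

lemma deriv_n:
  assumes "r > 0"
  shows "(n has_real_derivative n r * (m r - n r)) (at r)"
proof -
  have "\<kappa> r * (m r - 2 * l r) + (3 - l r * (2 * l r + m r) + 4 / (a r)\<^sup>2 - 2 * (\<kappa> r)\<^sup>2)
      = n r * (m r - n r)"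
    using constraint[OF assms, folded \<kappa>_def] unfolding n_def by algebra
  then show ?thesis
    using DERIV_add[OF deriv_\<kappa>[OF assms] deriv_l[OF assms, folded \<kappa>_def]]
    by (simp add: n_def[abs_def])
qed

lemma deriv_w:
  assumes "r > 0"
  shows "(w has_real_derivative - 3 * n r * w r) (at r)"
proof -
  have "(w has_real_derivative n r * (m r - n r) * (m r - \<kappa> r)
      + ((3 - m r * (2 * l r + m r) + 2 * (\<kappa> r)\<^sup>2) - \<kappa> r * (m r - 2 * l r)) * n r) (at r)"
    unfolding w_def[abs_def]
    by (rule derivative_eq_intros deriv_n deriv_\<kappa> deriv_m[folded \<kappa>_def] assms refl)+ simp
  moreover have "n r * (m r - n r) * (m r - \<kappa> r)
      + ((3 - m r * (2 * l r + m r) + 2 * (\<kappa> r)\<^sup>2) - \<kappa> r * (m r - 2 * l r)) * n r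
      = - 3 * n r * w r"
    unfolding w_def n_def by algebra
  ultimately show ?thesis by simp
qed

lemma \<kappa>_nut: "((\<lambda>r. r * \<kappa> r) \<longlongrightarrow> 1) (at_right 0)"
proof -
  have "((\<lambda>r. (b r / r) / (a r / r)\<^sup>2) \<longlongrightarrow> 1 / 1\<^sup>2) (at_right 0)"
    by (intro tendsto_intros a_nut b_nut) auto
  moreover have "\<forall>\<^sub>F r in at_right 0. (b r / r) / (a r / r)\<^sup>2 = r * \<kappa> r"
    using eventually_at_right_less[of 0]
    by eventually_elim (use a_pos in \<open>auto simp: \<kappa>_def field_simps power2_eq_square\<close>)
  ultimately show ?thesis by (simp add: tendsto_cong)
qed

lemma n_nut: "((\<lambda>r. r * n r) \<longlongrightarrow> 2) (at_right 0)"
  using tendsto_add[OF \<kappa>_nut l_nut] by (simp add: n_def algebra_simps)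

text \<open>The 1/r terms of \<open>m\<close> and \<open>\<kappa>\<close> cancel, so w = o(r^(-2)).
  This weak bound already excludes growth of order r^(-6).\<close>

lemma w_nut: "((\<lambda>r. r\<^sup>2 * w r) \<longlongrightarrow> 0) (at_right 0)"
proof -
  have "((\<lambda>r. (r * n r) * (r * m r - r * \<kappa> r) - r\<^sup>2) \<longlongrightarrow> 2 * (1 - 1) - 0\<^sup>2) (at_right 0)"
    by (intro tendsto_intros n_nut m_nut \<kappa>_nut)
  then show ?thesis by (simp add: w_def algebra_simps power2_eq_square)
qed

text \<open>Since \<open>n \<sim> 2/r\<close>, the equation \<open>w' = -3nw\<close> makes a nonzero \<open>w\<close> grow like \<open>r^(-6)\<close>
  at the nut.\<close>

lemma w_eq_0_near_nut: "\<exists>\<delta>>0. \<forall>r. 0 < r \<and> r < \<delta> \<longrightarrow> w r = 0"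
proof -
  have "\<forall>\<^sub>F r in at_right 0. r * n r > 5/3"
    using order_tendstoD(1)[OF n_nut, of "5/3"] by simp
  then obtain \<delta> where \<delta>: "\<delta> > 0" "\<And>r. 0 < r \<Longrightarrow> r < \<delta> \<Longrightarrow> r * n r > 5/3"
    unfolding eventually_at_right_field by auto
  \<comment> \<open>The exponent 10 leaves room on both sides: it is large enough for
    \<open>w_nut\<close> to give f -> 0, and below 6 * 2 = 12, so f decreases where r n > 10/6 =
    5/3. A nonnegative decreasing function with limit 0 at its left end vanishes.\<close>
  define f where "f r = r ^ 10 * (w r)\<^sup>2" for r
  have f0: "(f \<longlongrightarrow> 0) (at_right 0)"
  proof -
    have "((\<lambda>r. r ^ 6 * (r\<^sup>2 * w r)\<^sup>2) \<longlongrightarrow> 0 ^ 6 * 0\<^sup>2) (at_right 0)"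
      by (intro tendsto_intros w_nut)
    moreover have "(\<lambda>r. r ^ 6 * (r\<^sup>2 * w r)\<^sup>2) = f"
      by (simp add: f_def fun_eq_iff power_mult_distrib flip: power_mult power_add mult.assoc)
    ultimately show ?thesis by simp
  qed
  have df: "(f has_real_derivative r ^ 9 * (w r)\<^sup>2 * (10 - 6 * (r * n r))) (at r)" if "r > 0" for r
    unfolding f_def[abs_def]
    by (rule derivative_eq_intros deriv_w that refl)+
       (simp add: algebra_simps power2_eq_square eval_nat_numeral)
  have anti: "f t \<le> f s" if "0 < s" "s \<le> t" "t < \<delta>" for s t
  proof (rule DERIV_nonpos_imp_nonincreasing[OF \<open>s \<le> t\<close>])
    fix r assume "s \<le> r" "r \<le> t"
    then have r: "0 < r" "r < \<delta>" using that by auto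
    have "r ^ 9 * (w r)\<^sup>2 * (10 - 6 * (r * n r)) \<le> 0"
      using \<delta>(2)[OF r] r by (intro mult_nonneg_nonpos) auto
    then show "\<exists>y. DERIV f r :> y \<and> y \<le> 0" using df[OF r(1)] by blast
  qed
  have "w t = 0" if "0 < t" "t < \<delta>" for t
  proof -
    have "\<forall>\<^sub>F s in at_right 0. f t \<le> f s"
      unfolding eventually_at_right_field using anti that by (intro exI[of _ t]) auto
    then have "f t \<le> 0"
      using f0 by (intro tendsto_lowerbound[OF f0]) auto
    then show ?thesis using that by (simp add: f_def mult_le_0_iff)
  qed
  then show ?thesis using \<delta>(1) by blast
qed

lemma isCont_n: "r > 0 \<Longrightarrow> isCont n r"
  using deriv_n DERIV_isCont by blast

text \<open>If N is an antiderivative of n, then exp (3 N) is an integrating factor for w' = -3nw,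
  so vanishing near the nut propagates to all r > 0.\<close>

lemma w_eq_0:
  assumes "r > 0"
  shows "w r = 0"
proof -
  have "\<exists>F. \<forall>x. 0 < ereal x \<longrightarrow> ereal x < \<infinity> \<longrightarrow> (F has_vector_derivative n x) (at x)"
    by (rule einterval_antiderivative) (auto intro: isCont_n)
  then obtain N where N: "\<And>x. x > 0 \<Longrightarrow> (N has_real_derivative n x) (at x)"
    by (auto simp: has_real_derivative_iff_has_vector_derivative)
  define f where "f x = w x * exp (3 * N x)" for x
  have df: "(f has_real_derivative 0) (at x)" if "x > 0" for x
    unfolding f_def[abs_def]
    by (rule derivative_eq_intros deriv_w N that refl)+ (simp add: algebra_simps)
  note const = deriv_zero_pos_reals_const[of f, OF df]
  obtain \<delta> where \<delta>: "\<delta> > 0" "\<And>r. 0 < r \<Longrightarrow> r < \<delta> \<Longrightarrow> w r = 0"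
    using w_eq_0_near_nut by blast
  define s where "s = min r (\<delta>/2)"
  have "0 < s" "s < \<delta>" using \<delta>(1) assms by (auto simp: s_def)
  then show ?thesis using const[of r s] assms \<delta>(2)[of s] by (simp add: f_def)
qed

lemma n_times: "r > 0 \<Longrightarrow> n r * (m r - \<kappa> r) = 1"
  using w_eq_0 by (simp add: w_def)

text \<open>By \<open>n_times\<close>, n has no zero, and it is positive near the nut; a sign change
  would contradict the intermediate value theorem.\<close>

lemma n_pos:
  assumes "r > 0"
  shows "n r > 0"
proof (rule ccontr)
  assume neg: "\<not> n r > 0"
  have "\<forall>\<^sub>F s in at_right 0. s * n s > 0"
    using order_tendstoD(1)[OF n_nut, of 0] by simp
  moreover have "\<forall>\<^sub>F s in at_right 0. 0 < s \<and> s < r"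
    using assms by (auto simp: eventually_at_right_field)
  ultimately have "\<forall>\<^sub>F s in at_right 0. 0 < s \<and> s < r \<and> n s > 0"
    by eventually_elim (auto simp: zero_less_mult_iff)
  then obtain s where s: "0 < s" "s < r" "n s > 0"
    using eventually_happens'[of "at_right (0::real)"] by auto
  have "\<exists>x\<ge>s. x \<le> r \<and> n x = 0"
    using s neg by (intro IVT2) (auto intro: isCont_n)
  then obtain x where "x > 0" "n x = 0" using s(1) by (meson less_le_trans)
  then show False using n_times[of x] by simp
qed

section \<open>The first integral and the scalar equation\<close>

lemma P_pos: "r > 0 \<Longrightarrow> P r > 0"
  by (simp add: P_def b_pos n_pos)

text \<open>The logarithmic derivatives of b and n are m and m - n; their difference is n.\<close>

lemma deriv_P:
  assumes "r > 0"
  shows "(P has_real_derivative n r * P r) (at r)"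
  unfolding P_def[abs_def] using n_pos[OF assms]
  by (auto intro!: derivative_eq_intros deriv_b deriv_n assms simp: field_simps)

lemma P_nut: "(P \<longlongrightarrow> 0) (at_right 0)"
proof -
  have "((\<lambda>r. 2 * (b r / r) * r\<^sup>2 / (r * n r)) \<longlongrightarrow> 2 * 1 * 0\<^sup>2 / 2) (at_right 0)"
    by (intro tendsto_intros n_nut b_nut) auto
  moreover have "\<forall>\<^sub>F r in at_right 0. 2 * (b r / r) * r\<^sup>2 / (r * n r) = P r"
    using eventually_at_right_less[of 0]
    by eventually_elim (use n_pos in \<open>auto simp: P_def field_simps power2_eq_square\<close>)
  ultimately show ?thesis by (simp add: tendsto_cong)
qed

text \<open>At infinity \<open>\<kappa>\<close> -> 0, hence n -> 1 and P behaves like 2b. So a^2/P^2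
  tends to q/4, while 1/P tends to 0.\<close>

lemma first_integral_inf: "((\<lambda>r. ((a r)\<^sup>2 - P r) / (P r)\<^sup>2) \<longlongrightarrow> q / 4) at_top"
proof -
  have ia: "((\<lambda>r. inverse (a r)) \<longlongrightarrow> 0) at_top"
    using a_inf by (rule tendsto_inverse_0_at_top)
  have "((\<lambda>r. inverse (a r) * inverse (a r / b r) + l r) \<longlongrightarrow> 0 * inverse (sqrt q) + 1) at_top"
    using q_pos by (intro tendsto_intros ia ratio_inf l_inf) auto
  moreover have pos: "\<forall>\<^sub>F r in at_top. r > (0::real)"
    by (rule eventually_gt_at_top)
  moreover have "\<forall>\<^sub>F r in at_top. inverse (a r) * inverse (a r / b r) + l r = n r"
    using pos by eventually_elim (use a_pos b_pos in \<open>simp add: n_def \<kappa>_def field_simps power2_eq_square\<close>)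
  ultimately have n_inf: "(n \<longlongrightarrow> 1) at_top" by (simp add: tendsto_cong)
  have "((\<lambda>r. (a r / b r)\<^sup>2 * (n r)\<^sup>2 / 4 - inverse (a r) * (a r / b r) * n r / 2)
      \<longlongrightarrow> (sqrt q)\<^sup>2 * 1\<^sup>2 / 4 - 0 * sqrt q * 1 / 2) at_top"
    by (intro tendsto_intros ia ratio_inf n_inf) auto
  moreover have "\<forall>\<^sub>F r in at_top. (a r / b r)\<^sup>2 * (n r)\<^sup>2 / 4 - inverse (a r) * (a r / b r) * n r / 2
      = ((a r)\<^sup>2 - P r) / (P r)\<^sup>2"
    using pos
  proof eventually_elim
    case (elim r)
    then show ?case using a_pos[of r] b_pos[of r] n_pos[of r]
      by (simp add: P_def field_simps power2_eq_square)
  qed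
  ultimately show ?thesis using q_pos by (simp add: tendsto_cong)
qed

lemma a_squared:
  assumes "r > 0"
  shows "(a r)\<^sup>2 = P r + q / 4 * (P r)\<^sup>2"
proof -
  define f where "f r = ((a r)\<^sup>2 - P r) / (P r)\<^sup>2" for r
  have df: "(f has_real_derivative 0) (at x)" if "x > 0" for x
  proof -
    have "(f has_real_derivative
        ((2 * (a x * l x) * a x - n x * P x) * (P x)\<^sup>2 - ((a x)\<^sup>2 - P x) * (2 * (n x * P x) * P x))
        / ((P x)\<^sup>2 * (P x)\<^sup>2)) (at x)"
      unfolding f_def[abs_def] using P_pos[OF that]
      by (auto intro!: derivative_eq_intros deriv_a deriv_P that)
    \<comment> \<open>Both sides equal 2b, since n - l = \<open>\<kappa>\<close> = b/a^2. Up to the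
      factor P^2, the numerator of the derivative is the difference of these two sides.\<close>
    moreover have "(a x)\<^sup>2 * (n x - l x) * 2 = n x * P x"
      using a_pos[OF that] n_pos[OF that] by (simp add: n_def[of x] \<kappa>_def P_def)
    then have "(2 * (a x * l x) * a x - n x * P x) * (P x)\<^sup>2
        - ((a x)\<^sup>2 - P x) * (2 * (n x * P x) * P x) = 0"
      by algebra
    ultimately show ?thesis by simp
  qed
  have "\<forall>\<^sub>F x in at_top. f x = f r"
    using eventually_gt_at_top[of 0]
    by eventually_elim (use deriv_zero_pos_reals_const[of f, OF df] assms in blast)
  then have "(f \<longlongrightarrow> f r) at_top" by (rule tendsto_eventually)
  moreover have "(f \<longlongrightarrow> q / 4) at_top"
    using first_integral_inf by (simp add: f_def[abs_def])
  ultimately have "f r = q / 4"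
    by (rule tendsto_unique[rotated]) simp
  then show ?thesis using P_pos[OF assms] by (simp add: f_def field_simps)
qed

text \<open>Since 1/n = m - \<open>\<kappa>\<close>, P equals 2b(m - \<open>\<kappa>\<close>), and
  the constraint becomes (na)^2 = 4 + a^2 + P; \<open>a_squared\<close> then removes a.\<close>

lemma na_squared:
  assumes "r > 0"
  shows "(n r * a r)\<^sup>2 = 4 + 2 * P r + q / 4 * (P r)\<^sup>2"
proof -
  have ne: "a r \<noteq> 0" "n r \<noteq> 0" using a_pos n_pos assms by (auto simp: less_le)
  have "n r * P r = 2 * (\<kappa> r * (a r)\<^sup>2)" using ne by (simp add: P_def \<kappa>_def)
  then have "n r * (n r * P r) = n r * (n r * (2 * (\<kappa> r * (a r)\<^sup>2 * (m r - \<kappa> r))))"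
    using n_times[OF assms] by algebra
  then have P: "P r = 2 * (\<kappa> r * (a r)\<^sup>2 * (m r - \<kappa> r))" using ne by simp
  have "4 = (a r)\<^sup>2 * ((l r)\<^sup>2 + 2 * l r * m r - 3 + (\<kappa> r)\<^sup>2)"
    using constraint[OF assms, folded \<kappa>_def] ne by (simp add: field_simps)
  then have "(n r * a r)\<^sup>2 = 4 + (a r)\<^sup>2 + P r"
    using P n_times[OF assms] unfolding n_def by algebra
  then show ?thesis using a_squared[OF assms] by simp
qed

text \<open>In terms of P the equation degenerates at 0 like P' = 2 sqrt P, where uniqueness fails.
  For the square root the right-hand side is positive everywhere, with value 1 at 0.\<close>

definition p :: "real \<Rightarrow> real" where "p r = sqrt (P r)"

lemma p_pos: "r > 0 \<Longrightarrow> p r > 0"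
  by (simp add: p_def P_pos)

lemma p_squared: "r > 0 \<Longrightarrow> (p r)\<^sup>2 = P r"
  by (simp add: p_def P_pos less_imp_le)

text \<open>p' = np/2, and (np)^2 = (na)^2 P/a^2, where (na)^2 and a^2/P are already known functions
  of P.\<close>

lemma deriv_p:
  assumes "r > 0"
  shows "(p has_real_derivative
    sqrt ((4 + 2 * (p r)\<^sup>2 + q / 4 * (p r) ^ 4) / (1 + q / 4 * (p r)\<^sup>2)) / 2) (at r)"
proof -
  have p4: "(p r) ^ 4 = (P r)\<^sup>2"
    using p_squared[OF assms] by (metis power_mult numeral_Bit0 mult_2 power2_eq_square power_add)
  have pos: "1 + q / 4 * P r > 0" using q_pos P_pos[OF assms] by (simp add: add_pos_pos)
  have a2: "(a r)\<^sup>2 = P r * (1 + q / 4 * P r)"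
    using a_squared[OF assms] by (simp add: algebra_simps power2_eq_square)
  have "(n r * p r)\<^sup>2 * (1 + q / 4 * P r) = (n r * a r)\<^sup>2"
    using a2 p_squared[OF assms] by algebra
  then have "(n r * p r)\<^sup>2 = (4 + 2 * P r + q / 4 * (P r)\<^sup>2) / (1 + q / 4 * P r)"
    using na_squared[OF assms] pos by (simp add: field_simps)
  then have "n r * p r
      = sqrt ((4 + 2 * (p r)\<^sup>2 + q / 4 * (p r) ^ 4) / (1 + q / 4 * (p r)\<^sup>2))"
    unfolding p4 p_squared[OF assms]
    using n_pos[OF assms] p_pos[OF assms] by (metis less_imp_le mult_nonneg_nonneg real_sqrt_unique)
  moreover have "(p has_real_derivative (n r * P r) * (inverse (sqrt (P r)) / 2)) (at r)"
    unfolding p_def[abs_def]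
    using DERIV_chain2[OF DERIV_real_sqrt deriv_P, of r] assms P_pos[OF assms] by (simp add: mult_ac)
  moreover have "(n r * P r) * (inverse (sqrt (P r)) / 2) = n r * p r / 2"
    using P_pos[OF assms] p_squared[OF assms] p_pos[OF assms]
    by (simp add: p_def[symmetric] field_simps power2_eq_square)
  ultimately show ?thesis by simp
qed

lemma p_nut: "(p \<longlongrightarrow> 0) (at_right 0)"
  using tendsto_real_sqrt[OF P_nut] by (simp add: p_def[abs_def])

end

section \<open>Uniqueness for the Einstein system\<close>

text \<open>An autonomous scalar equation with positive right-hand side is solved by a quadrature, so
  both solutions have the same value of the strictly increasing primitive of \<open>1 / G\<close>.\<close>

lemma autonomous_unique:
  fixes G f g :: "real \<Rightarrow> real"
  assumes G: "continuous_on UNIV G" "\<And>t. G t > 0"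
    and f: "\<And>r. r > 0 \<Longrightarrow> (f has_real_derivative G (f r)) (at r)" "(f \<longlongrightarrow> f0) (at_right 0)"
    and g: "\<And>r. r > 0 \<Longrightarrow> (g has_real_derivative G (g r)) (at r)" "(g \<longlongrightarrow> f0) (at_right 0)"
    and "r > 0"
  shows "f r = g r"
proof -
  have "\<exists>F. \<forall>x. - \<infinity> < ereal x \<longrightarrow> ereal x < \<infinity> \<longrightarrow> (F has_vector_derivative 1 / G x) (at x)"
    using G by (intro einterval_antiderivative)
      (auto simp: continuous_on_eq_continuous_at less_le intro!: continuous_intros)
  then obtain H where H: "\<And>t. (H has_real_derivative 1 / G t) (at t)"
    by (auto simp: has_real_derivative_iff_has_vector_derivative)
  have "H (h r) = r + H f0"
    if h: "\<And>r. r > 0 \<Longrightarrow> (h has_real_derivative G (h r)) (at r)" "(h \<longlongrightarrow> f0) (at_right 0)" for h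
  proof -
    define F where "F s = H (h s) - s" for s
    have df: "(F has_real_derivative 0) (at s)" if "s > 0" for s
      unfolding F_def[abs_def] using G(2)[of "h s"] DERIV_chain2[OF H h(1)[OF that]]
      by (auto intro!: derivative_eq_intros)
    have "\<forall>\<^sub>F s in at_right 0. F s = F r"
      using eventually_at_right_less[of 0]
      by eventually_elim (use deriv_zero_pos_reals_const[of F, OF df] \<open>r > 0\<close> in blast)
    then have "(F \<longlongrightarrow> F r) (at_right 0)" by (rule tendsto_eventually)
    moreover have "(F \<longlongrightarrow> H f0 - 0) (at_right 0)"
      unfolding F_def[abs_def]
      by (intro tendsto_intros isCont_tendsto_compose[OF _ h(2)] DERIV_isCont[OF H])
    ultimately have "F r = H f0 - 0"
      by (rule tendsto_unique[rotated]) simp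
    then show ?thesis by (simp add: F_def)
  qed
  from this[of f] this[of g] f g have "H (f r) = H (g r)" by simp
  moreover have "strict_mono H"
    by (rule strict_monoI, rule DERIV_pos_imp_increasing) (use H G(2) in force)+
  ultimately show ?thesis by (simp add: strict_mono_eq)
qed

text \<open>The scalar equation determines p and hence P; then \<open>a_squared\<close> gives a,
  \<open>na_squared\<close> gives n, and b = nP/2.\<close>

lemma biaxial_einstein_unique:
  assumes "biaxial_einstein a b l m q" "biaxial_einstein a' b' l' m' q" and "r > 0"
  shows "a r = a' r" "b r = b' r"
proof -
  interpret e: biaxial_einstein a b l m q by fact
  interpret e': biaxial_einstein a' b' l' m' q by fact
  define G where "G t = sqrt ((4 + 2 * t\<^sup>2 + q / 4 * t ^ 4) / (1 + q / 4 * t\<^sup>2)) / 2" for t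
  have den: "1 + q / 4 * t\<^sup>2 > 0" and num: "4 + 2 * t\<^sup>2 + q / 4 * t ^ 4 > 0" for t
    using e.q_pos by (auto intro!: add_pos_nonneg)
  have "e.p r = e'.p r"
  proof (rule autonomous_unique[where f = e.p and g = e'.p and G = G and ?f0.0 = 0])
    show "continuous_on UNIV G"
      unfolding G_def using den by (intro continuous_intros) (auto simp: less_le)
    show "G t > 0" for t
      unfolding G_def using den[of t] num[of t] by simp
  qed (use e.deriv_p e'.deriv_p e.p_nut e'.p_nut \<open>r > 0\<close> in \<open>auto simp: G_def\<close>)
  then have P: "e.P r = e'.P r"
    using e.p_squared e'.p_squared \<open>r > 0\<close> by metis
  then have "(a r)\<^sup>2 = (a' r)\<^sup>2"
    using e.a_squared e'.a_squared \<open>r > 0\<close> by simp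
  then show a: "a r = a' r"
    using e.a_pos e'.a_pos \<open>r > 0\<close> by (simp add: power2_eq_iff_nonneg less_imp_le)
  have "(e.n r * a r)\<^sup>2 = (e'.n r * a' r)\<^sup>2"
    using e.na_squared e'.na_squared P \<open>r > 0\<close> by simp
  then have "e.n r * a r = e'.n r * a' r"
    using e.a_pos e'.a_pos e.n_pos e'.n_pos \<open>r > 0\<close>
    by (simp add: power2_eq_iff_nonneg less_imp_le)
  then have "e.n r = e'.n r" using a e.a_pos[OF \<open>r > 0\<close>] by simp
  then show "b r = b' r"
    using P e.n_pos[OF \<open>r > 0\<close>] by (simp add: e.P_def e'.P_def)
qed

section \<open>Passage from x in (0,1) to r = - ln x: x = 1 is the nut, x = 0 is infinity\<close>

lemma smooth01_has_deriv:
  assumes "smooth01 f" "x \<in> {0..1}"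
  shows "(f has_real_derivative deriv01 f x) (at x within {0..1})"
proof -
  have "f differentiable_on {0..1}"
    using assms(1) unfolding smooth01_def by (metis funpow_0)
  then have "f differentiable (at x within {0..1})"
    using assms(2) by (simp add: differentiable_on_def)
  then show ?thesis
    by (simp add: vector_derivative_works deriv01_def has_real_derivative_iff_has_vector_derivative)
qed

lemma smooth01_deriv01: "smooth01 f \<Longrightarrow> smooth01 (deriv01 f)"
  unfolding smooth01_def by (metis funpow_swap1 funpow.simps(2) comp_apply)

lemma smooth01_continuous_on: "smooth01 f \<Longrightarrow> continuous_on {0..1} f"
  using smooth01_has_deriv DERIV_continuous_on by blast

lemma smooth01_exp_deriv:
  assumes "smooth01 f" "r > 0"
  shows "((\<lambda>r. f (exp (- r))) has_real_derivative - exp (- r) * deriv01 f (exp (- r))) (at r)"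
proof -
  have "(f has_real_derivative deriv01 f (exp (- r))) (at (exp (- r)))"
    using smooth01_has_deriv[OF assms(1), of "exp (- r)"] assms(2)
    by (simp add: at_within_Icc_at)
  moreover have "((\<lambda>r. exp (- r)) has_real_derivative - exp (- r)) (at r)"
    by (auto intro!: derivative_eq_intros)
  ultimately show ?thesis
    using DERIV_chain2[where f = f and g = "\<lambda>r. exp (- r)" and x = r] by (force simp: mult.commute)
qed

lemma smooth01_exp_nut:
  assumes "smooth01 f"
  shows "((\<lambda>r. f (exp (- r))) \<longlongrightarrow> f 1) (at_right 0)"
proof -
  have "(f \<longlongrightarrow> f 1) (at_left 1)"
    using smooth01_continuous_on[OF assms] by (auto simp: continuous_on_Icc_at_leftD)
  moreover have "filterlim (\<lambda>r::real. exp (- r)) (at_left 1) (at_right 0)"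
    by real_asymp
  ultimately show ?thesis by (rule filterlim_compose)
qed

lemma smooth01_exp_inf:
  assumes "smooth01 f"
  shows "((\<lambda>r. f (exp (- r))) \<longlongrightarrow> f 0) at_top"
proof -
  have "(f \<longlongrightarrow> f 0) (at_right 0)"
    using smooth01_continuous_on[OF assms] by (auto simp: continuous_on_Icc_at_rightD)
  moreover have "filterlim (\<lambda>r::real. exp (- r)) (at_right 0) at_top"
    by real_asymp
  ultimately show ?thesis by (rule filterlim_compose)
qed

text \<open>\<open>c1\<close> and \<open>c2\<close> are x y1'(x) and x y2'(x), that is, minus the
  r-derivatives. The second and third equations supply the evolution of l and m; the first enters
  through the constraint.\<close>

lemma bvp_solution_biaxial_einstein:
  assumes "bvp_solution lam1 lam2 y1 y2"
  defines "c1 \<equiv> \<lambda>r. exp (- r) * deriv01 y1 (exp (- r))"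
    and "c2 \<equiv> \<lambda>r. exp (- r) * deriv01 y2 (exp (- r))"
  shows "biaxial_einstein
    (\<lambda>r. sinh r * exp ((y1 (exp (- r)) + y2 (exp (- r))) / 6))
    (\<lambda>r. sinh r * exp ((y1 (exp (- r)) - 2 * y2 (exp (- r))) / 6))
    (\<lambda>r. cosh r / sinh r - (c1 r + c2 r) / 6)
    (\<lambda>r. cosh r / sinh r - (c1 r - 2 * c2 r) / 6)
    (lam2 / lam1)"
proof -
  have sm: "smooth01 y1" "smooth01 y2" and ode: "ode_system y1 y2"
    and bc: "boundary_conditions lam1 lam2 y1 y2"
    using assms(1) by (auto simp: bvp_solution_def)
  have bv: "exp (y2 0) = lam2 / lam1" "y1 1 = 0" "y2 1 = 0"
    using bc by (auto simp: boundary_conditions_def Let_def)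
  have q_pos: "lam2 / lam1 > 0" using bv(1) by (metis exp_gt_zero)
  \<comment> \<open>Abbreviations at x = exp (-r): \<open>A\<close> and \<open>B\<close> are x^2
    y1'' and x^2 y2'', while \<open>e\<close> and \<open>f\<close> are the two products of powers of
    K and \<open>\<phi>\<close> in the equations.\<close>
  define A where "A r = (exp (- r))\<^sup>2 * deriv01 (deriv01 y1) (exp (- r))" for r
  define B where "B r = (exp (- r))\<^sup>2 * deriv01 (deriv01 y2) (exp (- r))" for r
  define e where "e r = exp (- (y1 (exp (- r)) + y2 (exp (- r))) / 3)" for r
  define f where "f r = exp (- (y1 (exp (- r)) + 4 * y2 (exp (- r))) / 3)" for r
  define t :: "real \<Rightarrow> real" where "t r = cosh r / sinh r" for r
  \<comment> \<open>Expressing 1/sinh^2 through t = coth r makes the later identities polynomial in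
    t, c1, c2, e and f.\<close>
  define T where "T r = (t r)\<^sup>2 - 1" for r
  have T: "T r = 1 / (sinh r)\<^sup>2" if "r > 0" for r
    using that unfolding T_def t_def by (simp add: power_divide field_simps cosh_square_eq)
  have dt: "(t has_real_derivative - T r) (at r)" if "r > 0" for r
  proof -
    have "((\<lambda>r. cosh r / sinh r) has_real_derivative
        (sinh r * sinh r - cosh r * cosh r) / (sinh r * sinh r)) (at r)"
      using that by (auto intro!: derivative_eq_intros)
    moreover have "sinh r * sinh r - cosh r * cosh r = - 1"
      using cosh_square_eq[of r] by (simp add: power2_eq_square)
    ultimately show ?thesis
      by (simp add: t_def[abs_def] T[OF that] power2_eq_square)
  qed
  have dc1: "(c1 has_real_derivative - c1 r - A r) (at r)"
    and dc2: "(c2 has_real_derivative - c2 r - B r) (at r)" if "r > 0" for r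
    unfolding c1_def c2_def A_def B_def
    by (auto intro!: derivative_eq_intros smooth01_exp_deriv smooth01_deriv01 sm that
          simp: power2_eq_square)
  have eqs: "A r + (c1 r)\<^sup>2 / 6 + (c2 r)\<^sup>2 / 3 - (2 * t r - 1) * c1 r = 0"
      "A r + (c1 r)\<^sup>2 / 2 - (6 * t r - 1) * c1 r + 2 * T r * (6 - 8 * e r + 2 * f r) = 0"
      "B r + c1 r * c2 r / 2 - (3 * t r - 1) * c2 r + 8 * T r * (f r - e r) = 0"
    if "r > 0" for r
  proof -
    define x where "x = exp (- r)"
    have x: "0 < x" "x < 1" using that by (auto simp: x_def)
    then have x2: "x\<^sup>2 < 1" by (simp add: power_less_one_iff)
    have ex: "exp r = 1 / x" by (simp add: x_def exp_minus field_simps)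
    have t: "t r = (1 + x\<^sup>2) / (1 - x\<^sup>2)"
      using x x2 unfolding t_def cosh_field_def sinh_field_def x_def[symmetric] ex
      by (simp add: field_simps power2_eq_square)
    have TT: "T r = 4 * x\<^sup>2 / (1 - x\<^sup>2)\<^sup>2"
    proof -
      have "(1 + x\<^sup>2)\<^sup>2 = (1 - x\<^sup>2)\<^sup>2 + 4 * x\<^sup>2" by algebra
      then show ?thesis
        unfolding T_def t power_divide using x2 by (simp add: add_divide_distrib)
    qed
    \<comment> \<open>Each singular coefficient is a polynomial in coth r divided by x or x^2, so
      multiplying the equations by x^2 removes every explicit x.\<close>
    have coeff: "(1 + 3 * x\<^sup>2) / (x * (1 - x\<^sup>2)) = (2 * t r - 1) / x"
      "(5 + 7 * x\<^sup>2) / (x * (1 - x\<^sup>2)) = (6 * t r - 1) / x"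
      "2 * (1 + 2 * x\<^sup>2) / (x * (1 - x\<^sup>2)) = (3 * t r - 1) / x"
      "8 / (1 - x\<^sup>2)\<^sup>2 = 2 * T r / x\<^sup>2" "32 / (1 - x\<^sup>2)\<^sup>2 = 8 * T r / x\<^sup>2"
      using x x2 by (simp_all add: t TT divide_simps)
    have ef: "exp (y1 x) powr (-1/3) * exp (y2 x) powr (-1/3) = e r"
      "exp (y1 x) powr (-1/3) * exp (y2 x) powr (-4/3) = f r"
      "e r * (1 / exp (y2 x)) = f r"
      by (simp_all add: e_def f_def x_def exp_powr_real flip: exp_add exp_minus exp_diff)
         (simp_all add: field_simps)
    have ef': "6 - 8 * exp (y1 x) powr (-1/3) * exp (y2 x) powr (-1/3)
        + 2 * exp (y1 x) powr (-1/3) * exp (y2 x) powr (-4/3) = 6 - 8 * e r + 2 * f r"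
      "c * exp (y1 x) powr (-1/3) * exp (y2 x) powr (-1/3) * (1 / exp (y2 x) - 1)
        = c * (f r - e r)" for c
      using ef by (simp_all only: mult.assoc right_diff_distrib[of _ "1 / exp (y2 x)"] mult_1_right)
        (simp_all add: algebra_simps)
    have ode_x: "deriv01 (deriv01 y1) x + 1/6 * (deriv01 y1 x)\<^sup>2 + 1/3 * (deriv01 y2 x)\<^sup>2
        - (2 * t r - 1) / x * deriv01 y1 x = 0"
      "deriv01 (deriv01 y1) x + 1/2 * (deriv01 y1 x)\<^sup>2 - (6 * t r - 1) / x * deriv01 y1 x
        + 2 * T r / x\<^sup>2 * (6 - 8 * e r + 2 * f r) = 0"
      "deriv01 (deriv01 y2) x + 1/2 * deriv01 y1 x * deriv01 y2 x
        - (3 * t r - 1) / x * deriv01 y2 x + 8 * T r / x\<^sup>2 * (f r - e r) = 0"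
      using ode[unfolded ode_system_def Let_def, rule_format, of x] x
      by (simp_all only: coeff ef' greaterThanLessThan_iff)
    have scale: "x\<^sup>2 * (u / x * v) = u * (x * v)" "x\<^sup>2 * (u / x\<^sup>2 * v) = u * v" for u v
      using x by (simp_all add: power2_eq_square)
    note scaled = ode_x[THEN arg_cong[of _ _ "\<lambda>z. x\<^sup>2 * z"],
        unfolded distrib_left[of "x\<^sup>2"] right_diff_distrib[of "x\<^sup>2"] scale mult_zero_right]
    show "A r + (c1 r)\<^sup>2 / 6 + (c2 r)\<^sup>2 / 3 - (2 * t r - 1) * c1 r = 0"
      "A r + (c1 r)\<^sup>2 / 2 - (6 * t r - 1) * c1 r + 2 * T r * (6 - 8 * e r + 2 * f r) = 0"
      "B r + c1 r * c2 r / 2 - (3 * t r - 1) * c2 r + 8 * T r * (f r - e r) = 0"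
      using scaled unfolding A_def B_def c1_def c2_def x_def[symmetric]
      by (simp_all add: algebra_simps power2_eq_square)
  qed
  define a where "a r = sinh r * exp ((y1 (exp (- r)) + y2 (exp (- r))) / 6)" for r
  define b where "b r = sinh r * exp ((y1 (exp (- r)) - 2 * y2 (exp (- r))) / 6)" for r
  define l where "l r = t r - (c1 r + c2 r) / 6" for r
  define m where "m r = t r - (c1 r - 2 * c2 r) / 6" for r
  have sq: "(exp (u / 6))\<^sup>2 = exp (u / 3)" for u :: real
    by (simp flip: exp_of_nat_mult)
  have neg: "exp (- u / 3) = 1 / exp (u / 3)" for u :: real
    using exp_minus[of "u / 3"] by (simp add: inverse_eq_divide)
  have a2: "4 / (a r)\<^sup>2 = 4 * T r * e r" if "r > 0" for r
    unfolding a_def e_def T[OF that] power_mult_distrib sq neg by simp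
  have k2: "(b r / (a r)\<^sup>2)\<^sup>2 = T r * f r" if "r > 0" for r
  proof -
    have "b r / (a r)\<^sup>2 = exp ((y1 (exp (- r)) - 2 * y2 (exp (- r))) / 6
        - (y1 (exp (- r)) + y2 (exp (- r))) / 3) / sinh r"
      unfolding a_def b_def power_mult_distrib sq exp_diff using that
      by (simp add: power2_eq_square)
    also have "(y1 (exp (- r)) - 2 * y2 (exp (- r))) / 6 - (y1 (exp (- r)) + y2 (exp (- r))) / 3
        = - (y1 (exp (- r)) + 4 * y2 (exp (- r))) / 6"
      by (simp add: field_simps)
    finally show ?thesis
      unfolding f_def T[OF that] by (simp add: power_divide sq)
  qed
  have "biaxial_einstein a b l m (lam2 / lam1)"
  proof
    show "a r > 0" "b r > 0" if "r > 0" for r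
      using that by (simp_all add: a_def b_def)
    show "lam2 / lam1 > 0" by (rule q_pos)
    fix r :: real assume r: "r > 0"
    have dy: "((\<lambda>r. y1 (exp (- r))) has_real_derivative - c1 r) (at r)"
      "((\<lambda>r. y2 (exp (- r))) has_real_derivative - c2 r) (at r)"
      using smooth01_exp_deriv[OF sm(1) r] smooth01_exp_deriv[OF sm(2) r]
      by (simp_all add: c1_def c2_def)
    show "(a has_real_derivative a r * l r) (at r)"
      unfolding a_def[abs_def] l_def t_def using r
      by (auto intro!: derivative_eq_intros dy simp: field_simps)
    show "(b has_real_derivative b r * m r) (at r)"
      unfolding b_def[abs_def] m_def t_def using r
      by (auto intro!: derivative_eq_intros dy simp: field_simps)
    have AB: "A r = - (c1 r)\<^sup>2 / 2 + (6 * t r - 1) * c1 r - 2 * T r * (6 - 8 * e r + 2 * f r)"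
      "B r = - c1 r * c2 r / 2 + (3 * t r - 1) * c2 r - 8 * T r * (f r - e r)"
      using eqs[OF r] by linarith+
    have "(l has_real_derivative - T r - ((- c1 r - A r) + (- c2 r - B r)) / 6) (at r)"
      unfolding l_def[abs_def] using r
      by (auto intro!: derivative_eq_intros dt dc1 dc2)
    moreover have "- T r - ((- c1 r - A r) + (- c2 r - B r)) / 6
        = 3 - l r * (2 * l r + m r) + 4 * T r * e r - 2 * (T r * f r)"
      unfolding AB l_def m_def T_def by (simp add: field_simps power2_eq_square)
    ultimately show "(l has_real_derivative
        3 - l r * (2 * l r + m r) + 4 / (a r)\<^sup>2 - 2 * (b r / (a r)\<^sup>2)\<^sup>2) (at r)"
      by (simp add: a2[OF r] k2[OF r])
    have "(m has_real_derivative - T r - ((- c1 r - A r) - 2 * (- c2 r - B r)) / 6) (at r)"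
      unfolding m_def[abs_def] using r
      by (auto intro!: derivative_eq_intros dt dc1 dc2)
    moreover have "- T r - ((- c1 r - A r) - 2 * (- c2 r - B r)) / 6
        = 3 - m r * (2 * l r + m r) + 2 * (T r * f r)"
      unfolding AB l_def m_def T_def by (simp add: field_simps power2_eq_square)
    ultimately show "(m has_real_derivative
        3 - m r * (2 * l r + m r) + 2 * (b r / (a r)\<^sup>2)\<^sup>2) (at r)"
      by (simp add: k2[OF r])
    \<comment> \<open>The second derivative cancels in the difference of the first two equations; a
      quarter of that difference is the constraint.\<close>
    have "(l r)\<^sup>2 + 2 * l r * m r = 3 + 4 * T r * e r - T r * f r"
      using eqs(1,2)[OF r] unfolding l_def m_def T_def
      by (simp add: field_simps power2_eq_square)
    then show "(l r)\<^sup>2 + 2 * l r * m r = 3 + 4 / (a r)\<^sup>2 - (b r / (a r)\<^sup>2)\<^sup>2"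
      by (simp add: a2[OF r] k2[OF r])
  next
    note nut = smooth01_exp_nut[OF sm(1)] smooth01_exp_nut[OF sm(2)]
      smooth01_exp_nut[OF smooth01_deriv01[OF sm(1)]] smooth01_exp_nut[OF smooth01_deriv01[OF sm(2)]]
    note inf = smooth01_exp_inf[OF sm(1)] smooth01_exp_inf[OF sm(2)]
      smooth01_exp_inf[OF smooth01_deriv01[OF sm(1)]] smooth01_exp_inf[OF smooth01_deriv01[OF sm(2)]]
    have sinh_nut: "((\<lambda>r::real. sinh r / r) \<longlongrightarrow> 1) (at_right 0)" by real_asymp
    show "((\<lambda>r. a r / r) \<longlongrightarrow> 1) (at_right 0)"
    proof -
      have "((\<lambda>r. sinh r / r * exp ((y1 (exp (- r)) + y2 (exp (- r))) / 6))
          \<longlongrightarrow> 1 * exp ((y1 1 + y2 1) / 6)) (at_right 0)"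
        by (intro tendsto_intros sinh_nut nut) auto
      then show ?thesis by (simp add: a_def bv)
    qed
    show "((\<lambda>r. b r / r) \<longlongrightarrow> 1) (at_right 0)"
    proof -
      have "((\<lambda>r. sinh r / r * exp ((y1 (exp (- r)) - 2 * y2 (exp (- r))) / 6))
          \<longlongrightarrow> 1 * exp ((y1 1 - 2 * y2 1) / 6)) (at_right 0)"
        by (intro tendsto_intros sinh_nut nut) auto
      then show ?thesis by (simp add: b_def bv)
    qed
    have t_nut: "((\<lambda>r. r * t r) \<longlongrightarrow> 1) (at_right 0)" unfolding t_def by real_asymp
    have rx_nut: "((\<lambda>r::real. r * exp (- r)) \<longlongrightarrow> 0) (at_right 0)" by real_asymp
    have c_nut: "((\<lambda>r. r * c1 r) \<longlongrightarrow> 0) (at_right 0)" "((\<lambda>r. r * c2 r) \<longlongrightarrow> 0) (at_right 0)"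
      using tendsto_mult[OF rx_nut nut(3)] tendsto_mult[OF rx_nut nut(4)]
      by (simp_all add: c1_def c2_def mult.assoc)
    have "((\<lambda>r. r * t r - (r * c1 r + r * c2 r) / 6) \<longlongrightarrow> 1 - (0 + 0) / 6) (at_right 0)"
      by (intro tendsto_intros t_nut c_nut) auto
    then show "((\<lambda>r. r * l r) \<longlongrightarrow> 1) (at_right 0)"
      by (simp add: l_def algebra_simps)
    have "((\<lambda>r. r * t r - (r * c1 r - 2 * (r * c2 r)) / 6) \<longlongrightarrow> 1 - (0 - 2 * 0) / 6) (at_right 0)"
      by (intro tendsto_intros t_nut c_nut) auto
    then show "((\<lambda>r. r * m r) \<longlongrightarrow> 1) (at_right 0)"
      by (simp add: m_def algebra_simps)
    have "filterlim (sinh :: real \<Rightarrow> real) at_top at_top" by real_asymp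
    moreover have "((\<lambda>r. exp ((y1 (exp (- r)) + y2 (exp (- r))) / 6))
        \<longlongrightarrow> exp ((y1 0 + y2 0) / 6)) at_top"
      by (intro tendsto_intros inf) auto
    ultimately show "filterlim a at_top at_top"
      unfolding a_def[abs_def] by (intro filterlim_at_top_mult_tendsto_pos) auto
    \<comment> \<open>a/b is the square root of \<open>\<phi>\<close>, so the prescribed
      \<open>\<phi>\<close> at 0 becomes the squashing at infinity.\<close>
    have "((\<lambda>r. exp (y2 (exp (- r)) / 2)) \<longlongrightarrow> exp (y2 0 / 2)) at_top"
      by (intro tendsto_intros inf) auto
    moreover have "exp (y2 0 / 2) = sqrt (lam2 / lam1)"
      by (rule real_sqrt_unique[symmetric]) (simp_all add: bv(1)[symmetric] flip: exp_of_nat_mult)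
    moreover have "\<forall>\<^sub>F r in at_top. exp (y2 (exp (- r)) / 2) = a r / b r"
      using eventually_gt_at_top[of 0]
      by eventually_elim (simp add: a_def b_def field_simps flip: exp_add)
    ultimately show "((\<lambda>r. a r / b r) \<longlongrightarrow> sqrt (lam2 / lam1)) at_top"
      by (simp add: tendsto_cong)
    have t_inf: "(t \<longlongrightarrow> 1) at_top" unfolding t_def[abs_def] by real_asymp
    have x_inf: "((\<lambda>r::real. exp (- r)) \<longlongrightarrow> 0) at_top" by real_asymp
    have "(l \<longlongrightarrow> 1 - (0 * deriv01 y1 0 + 0 * deriv01 y2 0) / 6) at_top"
      unfolding l_def[abs_def] c1_def c2_def
      by (intro tendsto_intros t_inf x_inf inf) auto
    then show "(l \<longlongrightarrow> 1) at_top" by simp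
  qed
  then show ?thesis
    by (simp add: a_def[abs_def] b_def[abs_def] l_def[abs_def] m_def[abs_def] t_def)
qed

section \<open>Uniqueness for the boundary value problem\<close>

theorem theorem5p4:
  fixes lam1 lam2 :: real and y1 y2 z1 z2 :: "real \<Rightarrow> real"
  assumes "lam1 > 0" and "lam2 > 0"
    and "(1/4 < lam2 / lam1 \<and> lam2 / lam1 < 1) \<or> (1 < lam2 / lam1 \<and> lam2 / lam1 < 4)"
    and "bvp_solution lam1 lam2 y1 y2"
    and "bvp_solution lam1 lam2 z1 z2"
  shows "\<forall>x\<in>{0..1}. y1 x = z1 x \<and> y2 x = z2 x"
proof -
  have eq: "y1 x = z1 x \<and> y2 x = z2 x" if x: "x \<in> {0<..<1}" for x
  proof -
    have r: "- ln x > 0" using x by simp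
    \<comment> \<open>Equality of a and of b at r = - ln x, with the common factor sinh r > 0
      cancelled; the two exponents are independent combinations of y1 and y2.\<close>
    have "exp ((y1 x + y2 x) / 6) = exp ((z1 x + z2 x) / 6)"
      "exp ((y1 x - 2 * y2 x) / 6) = exp ((z1 x - 2 * z2 x) / 6)"
      using biaxial_einstein_unique[OF assms(4,5)[THEN bvp_solution_biaxial_einstein] r] x r
      by simp_all
    then show ?thesis by simp
  qed
  have "continuous_on {0..1} y1" "continuous_on {0..1} y2"
    "continuous_on {0..1} z1" "continuous_on {0..1} z2"
    using assms(4,5) by (auto simp: bvp_solution_def intro: smooth01_continuous_on)
  \<comment> \<open>The endpoints, which the variable r does not reach, follow by
    continuity.\<close>
  then have "continuous_on (closure {0<..<1}) (\<lambda>x. y1 x - z1 x)"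
    "continuous_on (closure {0<..<1}) (\<lambda>x. y2 x - z2 x)"
    by (auto intro: continuous_intros)
  then have "y1 x - z1 x = 0" "y2 x - z2 x = 0" if "x \<in> {0..1}" for x
    using that eq continuous_constant_on_closure[of "{0<..<1}" "\<lambda>x. y1 x - z1 x" 0 x]
      continuous_constant_on_closure[of "{0<..<1}" "\<lambda>x. y2 x - z2 x" 0 x] by auto
  then show ?thesis by simp
qed

end
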